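(* Let $Y$ be a subspace of a geodesic metric space $X$ and let $\epsilon\ge0$. Suppose the empty set is not in the image of $\pi_Y^\epsilon$. The following are equivalent: (1) There exist a sublinear function $\rho$ and a constant $C\ge 0$ such that for every geodesic segment $\gamma\subset X$, with endpoints denoted $x$ and $y$, if $d(\gamma,Y)\ge C$ then $\operatorname{diam}\pi_Y^\epsilon(\gamma)\le\rho(\max\{d(x,Y),d(y,Y)\})$. (2) There exist a sublinear function $\rho'$ and a constant $C'\ge 0$ such that for every geodesic segment $\gamma\subset X$, if $d(\gamma,Y)\ge C'$ then $\operatorname{diam}\pi_Y^\epsilon(\gamma)\le\rho'(\max_{z\in\gamma}d(z,Y))$. (3) There exists a sublinear function $\rho''$ such that $\pi_Y^\epsilon$ is $(r,\rho'')$-contracting. Moreover, $\rho\asymp\rho'\asymp\rho''$; that is, given a function as in any one of the conditions, the functions in the other conditions can be chosen asymptotic to it.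
   Context: Functions are real valued with domain $[0,\infty)$. A function $f$ is sublinear if it is non-decreasing, eventually non-negative, and $\lim_{r\to\infty}f(r)/r=0$. Write $f\preceq g$ if there exist $C_1>0,C_2>0,C_3\ge0,C_4\ge0$ with $f(r)\le C_1g(C_2r+C_3)+C_4$ for all $r$; $f\asymp g$ ("asymptotic") means $f\preceq g$ and $g\preceq f$. The $\epsilon$-closest point projection is $\pi_Y^\epsilon\colon X\to 2^Y$, $\pi^\epsilon_Y(x)=\{y\in Y\mid d(x,y)\le d(x,Y)+\epsilon\}$; for $Z\subset X$, $\pi_Y^\epsilon(Z)=\bigcup_{z\in Z}\pi_Y^\epsilon(z)$. The map $\pi_Y^\epsilon$ is $(r,\rho'')$-contracting if the empty set is not in its image, $\rho''$ is non-decreasing and eventually non-negative with $\lim_{r\to\infty}\rho''(r)/r=0$, and for all $x,x'\in X$, $d(x,x')\le d(x,Y)$ implies $\operatorname{diam}(\pi_Y^\epsilon(x)\cup\pi_Y^\epsilon(x'))\le\rho''(d(x,Y))$. For sets, $d(\gamma,Y)=\inf\{d(z,y)\mid z\in\gamma,y\in Y\}$. *)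

theory Defs
  imports "HOL-Analysis.Analysis"
begin

text \<open>
  Functions with domain \<open>[0,\<infinity>)\<close> are represented by total functions on the reals of
  which only the values on \<open>{0..}\<close> are ever constrained or used.
\<close>

definition sublinear :: "(real \<Rightarrow> real) \<Rightarrow> bool" where
  "sublinear f \<longleftrightarrow>
     mono_on {0..} f \<and> (\<forall>\<^sub>F r in at_top. 0 \<le> f r) \<and> ((\<lambda>r. f r / r) \<longlongrightarrow> 0) at_top"

definition asymp_le :: "(real \<Rightarrow> real) \<Rightarrow> (real \<Rightarrow> real) \<Rightarrow> bool" where
  "asymp_le f g \<longleftrightarrow>
     (\<exists>C1>0. \<exists>C2>0. \<exists>C3\<ge>0. \<exists>C4\<ge>0. \<forall>r\<ge>0. f r \<le> C1 * g (C2 * r + C3) + C4)"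

definition asymptotic :: "(real \<Rightarrow> real) \<Rightarrow> (real \<Rightarrow> real) \<Rightarrow> bool" where
  "asymptotic f g \<longleftrightarrow> asymp_le f g \<and> asymp_le g f"

text \<open>Segments are allowed to be degenerate (\<open>l = 0\<close>).\<close>

definition geodesic_segment :: "'a::metric_space set \<Rightarrow> 'a \<Rightarrow> 'a \<Rightarrow> bool" where
  "geodesic_segment \<gamma> x y \<longleftrightarrow>
     (\<exists>l\<ge>0. \<exists>c. c 0 = x \<and> c l = y \<and> \<gamma> = c ` {0..l} \<and>
        (\<forall>s\<in>{0..l}. \<forall>t\<in>{0..l}. dist (c s) (c t) = \<bar>s - t\<bar>))"

definition geodesic_space :: "'a::metric_space itself \<Rightarrow> bool" where
  "geodesic_space _ \<longleftrightarrow> (\<forall>x y :: 'a. \<exists>\<gamma>. geodesic_segment \<gamma> x y)"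

text \<open>
  The constant \<^const>\<open>diameter\<close> is real valued and carries no information on unbounded sets,
  so an upper bound on the diameter has to include boundedness.
\<close>

definition diam_le :: "'a::metric_space set \<Rightarrow> real \<Rightarrow> bool" where
  "diam_le S b \<longleftrightarrow> bounded S \<and> diameter S \<le> b"

definition proj :: "real \<Rightarrow> 'a::metric_space set \<Rightarrow> 'a \<Rightarrow> 'a set" where
  "proj \<epsilon> Y x = {y \<in> Y. dist x y \<le> infdist x Y + \<epsilon>}"

definition proj_set :: "real \<Rightarrow> 'a::metric_space set \<Rightarrow> 'a set \<Rightarrow> 'a set" where
  "proj_set \<epsilon> Y Z = (\<Union>z\<in>Z. proj \<epsilon> Y z)"

text \<open>\<open>contracting \<epsilon> Y \<rho>\<close>: the \<open>\<epsilon>\<close>-closest point projection to \<open>Y\<close> is \<open>(r, \<rho>)\<close>-contracting.\<close>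

definition contracting :: "real \<Rightarrow> 'a::metric_space set \<Rightarrow> (real \<Rightarrow> real) \<Rightarrow> bool" where
  "contracting \<epsilon> Y \<rho> \<longleftrightarrow>
     {} \<notin> range (proj \<epsilon> Y) \<and> sublinear \<rho> \<and>
     (\<forall>x x'. dist x x' \<le> infdist x Y \<longrightarrow>
        diam_le (proj \<epsilon> Y x \<union> proj \<epsilon> Y x') (\<rho> (infdist x Y)))"

definition endpoint_condition :: "real \<Rightarrow> 'a::metric_space set \<Rightarrow> (real \<Rightarrow> real) \<Rightarrow> bool" where
  "endpoint_condition \<epsilon> Y \<rho> \<longleftrightarrow>
     sublinear \<rho> \<and>
     (\<exists>C\<ge>0. \<forall>\<gamma> x y. geodesic_segment \<gamma> x y \<longrightarrow> setdist \<gamma> Y \<ge> C \<longrightarrow>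
        diam_le (proj_set \<epsilon> Y \<gamma>) (\<rho> (max (infdist x Y) (infdist y Y))))"

text \<open>
  The supremum below is a maximum because segments are compact; \<^const>\<open>Max\<close> would only
  be meaningful on finite sets.
\<close>

definition segment_condition :: "real \<Rightarrow> 'a::metric_space set \<Rightarrow> (real \<Rightarrow> real) \<Rightarrow> bool" where
  "segment_condition \<epsilon> Y \<rho> \<longleftrightarrow>
     sublinear \<rho> \<and>
     (\<exists>C\<ge>0. \<forall>\<gamma> x y. geodesic_segment \<gamma> x y \<longrightarrow> setdist \<gamma> Y \<ge> C \<longrightarrow>
        diam_le (proj_set \<epsilon> Y \<gamma>) (\<rho> (SUP z\<in>\<gamma>. infdist z Y)))"

end

theory Submission
  imports Defs
begin

text \<open>
  Write \<open>f z = d(z, Y)\<close>. For (2) \<open>\<Longrightarrow>\<close> (3), follow a geodesic from \<open>x\<close> to \<open>x'\<close> until \<open>f\<close> first drops to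
  the constant \<open>C'\<close>; as \<open>d(x, x') \<le> f x\<close>, the rest of the geodesic has length at most \<open>C'\<close>.

  For (3) \<open>\<Longrightarrow>\<close> (1), choose \<open>C\<close> with \<open>\<rho>'' r \<le> r / 10\<close> for \<open>r \<ge> C\<close>, and let \<open>M\<close> be the maximum of \<open>f\<close>
  at the endpoints \<open>x\<close>, \<open>y\<close>. Cut off initial and final pieces of lengths \<open>f x\<close> and \<open>f y\<close>: each
  projects to a set of diameter at most \<open>\<rho>'' M\<close>. If \<open>L\<close> is the length of the remaining middle piece
  and \<open>D\<close> the distance between the projections of its endpoints, then the triangle inequality
  through the projections of \<open>x\<close> and \<open>y\<close> gives \<open>L \<le> D + 2 \<rho>'' M + 2 \<epsilon>\<close>. Moving along the middle
  piece in steps of length \<open>f\<close> gives \<open>D \<le> 3 L / 10\<close>, unless a single step suffices. Hence \<open>L\<close> and \<open>D\<close>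
  are bounded linearly in \<open>\<rho>'' M\<close>.
\<close>

section \<open>Diameter bounds\<close>

text \<open>The empty set has diameter 0; \<open>0 \<le> b\<close> takes care of that case.\<close>

lemma diam_leI:
  assumes "\<And>u v. u \<in> S \<Longrightarrow> v \<in> S \<Longrightarrow> dist u v \<le> b" and "0 \<le> b"
  shows "diam_le S b"
  unfolding diam_le_def
proof
  show "bounded S"
    using assms(1) by (meson bounded_two_points)
  show "diameter S \<le> b"
    using assms by (auto simp: diameter_def intro!: cSUP_least)
qed

lemma diam_leD:
  assumes "diam_le S b" "u \<in> S" "v \<in> S"
  shows "dist u v \<le> b"
  using assms diameter_bounded_bound[of S u v] by (auto simp: diam_le_def)

section \<open>Asymptotic comparison as an equivalence relation\<close>

lemma asymptotic_refl: "asymptotic f f"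
proof -
  have "asymp_le f f"
    unfolding asymp_le_def
    by (rule exI[of _ 1], simp, rule exI[of _ 1], simp, rule exI[of _ 0], simp, rule exI[of _ 0], simp)
  then show ?thesis by (simp add: asymptotic_def)
qed

lemma asymptotic_sym: "asymptotic f g \<Longrightarrow> asymptotic g f"
  by (simp add: asymptotic_def)

lemma asymp_leI:
  assumes "C1 > 0" "C2 > 0" "C3 \<ge> 0" "C4 \<ge> 0" "\<And>r. r \<ge> 0 \<Longrightarrow> f r \<le> C1 * g (C2 * r + C3) + C4"
  shows "asymp_le f g"
  unfolding asymp_le_def using assms by blast

lemma asymp_le_trans:
  assumes "asymp_le f g" "asymp_le g h"
  shows "asymp_le f h"
proof -
  obtain C1 C2 C3 C4 where C: "C1 > 0" "C2 > 0" "C3 \<ge> 0" "C4 \<ge> 0"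
    "\<And>r. r \<ge> 0 \<Longrightarrow> f r \<le> C1 * g (C2 * r + C3) + C4"
    using assms(1) unfolding asymp_le_def by blast
  obtain D1 D2 D3 D4 where D: "D1 > 0" "D2 > 0" "D3 \<ge> 0" "D4 \<ge> 0"
    "\<And>r. r \<ge> 0 \<Longrightarrow> g r \<le> D1 * h (D2 * r + D3) + D4"
    using assms(2) unfolding asymp_le_def by blast
  show ?thesis
  proof (rule asymp_leI)
    show "0 < C1 * D1" "0 < D2 * C2" "0 \<le> D2 * C3 + D3" "0 \<le> C1 * D4 + C4"
      using C D by auto
    fix r :: real assume r: "r \<ge> 0"
    have "g (C2 * r + C3) \<le> D1 * h (D2 * (C2 * r + C3) + D3) + D4"
      using C r by (intro D(5)) simp
    then have "C1 * g (C2 * r + C3) \<le> C1 * (D1 * h (D2 * (C2 * r + C3) + D3) + D4)"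
      using C(1) by (intro mult_left_mono) auto
    with C(5)[OF r] show "f r \<le> C1 * D1 * h (D2 * C2 * r + (D2 * C3 + D3)) + (C1 * D4 + C4)"
      by (simp add: algebra_simps)
  qed
qed

lemma asymptotic_trans: "asymptotic f g \<Longrightarrow> asymptotic g h \<Longrightarrow> asymptotic f h"
  unfolding asymptotic_def using asymp_le_trans by blast

section \<open>Sublinear functions and their rescalings\<close>

lemma sublinear_mono: "sublinear f \<Longrightarrow> 0 \<le> r \<Longrightarrow> r \<le> s \<Longrightarrow> f r \<le> f s"
  unfolding sublinear_def by (auto intro: mono_onD)

text \<open>The functions constructed below have this form. The truncation \<open>max 0\<close> is
  there because a sublinear function may be negative at small arguments, while a diameter bound may
  not. The limit rests on \<open>f (k * r) / r = k * (f (k * r) / (k * r))\<close>.\<close>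

lemma sublinear_rescale:
  assumes f: "sublinear f" and "a > 0" "k > 0" "b \<ge> 0"
  shows "sublinear (\<lambda>r. a * max 0 (f (k * r)) + b)"
proof -
  let ?g = "\<lambda>r. a * max 0 (f (k * r)) + b"
  have lim: "((\<lambda>r. f r / r) \<longlongrightarrow> 0) at_top"
    using f by (simp add: sublinear_def)
  have "filterlim (\<lambda>r. k * r) at_top at_top"
    using \<open>k > 0\<close> by (intro filterlim_tendsto_pos_mult_at_top[OF tendsto_const _ filterlim_ident])
  from filterlim_compose[OF lim this]
  have "((\<lambda>r. k * (f (k * r) / (k * r))) \<longlongrightarrow> k * 0) at_top"
    by (rule tendsto_mult_left)
  then have "((\<lambda>r. f (k * r) / r) \<longlongrightarrow> 0) at_top"
    using \<open>k > 0\<close> by simp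
  then have "((\<lambda>r. a * max 0 (f (k * r) / r) + b / r) \<longlongrightarrow> a * max 0 0 + 0) at_top"
    by (intro tendsto_intros tendsto_divide_0[OF tendsto_const] filterlim_at_top_imp_at_infinity
        filterlim_ident)
  moreover have "\<forall>\<^sub>F r in at_top. a * max 0 (f (k * r) / r) + b / r = ?g r / r"
    using eventually_gt_at_top[of 0]
    by eventually_elim (auto simp: add_divide_distrib max_def zero_le_divide_iff divide_le_0_iff)
  ultimately have "((\<lambda>r. ?g r / r) \<longlongrightarrow> 0) at_top"
    using tendsto_cong by force
  moreover have "mono_on {0..} ?g"
    using \<open>a > 0\<close> \<open>k > 0\<close> sublinear_mono[OF f]
    by (intro mono_onI add_right_mono mult_left_mono max.mono) auto
  ultimately show ?thesis
    using \<open>a > 0\<close> \<open>b \<ge> 0\<close> by (simp add: sublinear_def)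
qed

text \<open>One direction is monotonicity. For the other, the argument is shifted by some
  \<open>R\<close> with \<open>0 \<le> f R\<close>; monotonicity makes \<open>f\<close> non-negative
  from there on, which absorbs the truncation.\<close>

lemma asymptotic_rescale:
  assumes f: "sublinear f" and "a \<ge> 1" "k \<ge> 1" "b \<ge> 0"
  shows "asymptotic f (\<lambda>r. a * max 0 (f (k * r)) + b)"
proof -
  have "\<forall>\<^sub>F r in at_top. 0 \<le> f r \<and> 0 \<le> r"
    using f eventually_ge_at_top[of 0] by (auto simp: sublinear_def intro: eventually_conj)
  then obtain R where R: "0 \<le> f R" "0 \<le> R"
    by (auto simp: eventually_at_top_linorder)
  have "asymp_le f (\<lambda>r. a * max 0 (f (k * r)) + b)"
  proof (rule asymp_leI[of 1 1 0 0])
    fix r :: real assume "r \<ge> 0"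
    then have "f r \<le> f (k * r)"
      using assms by (intro sublinear_mono[OF f]) (auto simp: mult_le_cancel_right1)
    also have "\<dots> \<le> 1 * max 0 (f (k * r))"
      by simp
    also have "\<dots> \<le> a * max 0 (f (k * r))"
      using assms by (intro mult_right_mono) auto
    finally show "f r \<le> 1 * (a * max 0 (f (k * (1 * r + 0))) + b) + 0"
      using assms by simp
  qed auto
  moreover have "asymp_le (\<lambda>r. a * max 0 (f (k * r)) + b) f"
  proof (rule asymp_leI[of a k R b])
    fix r :: real assume "r \<ge> 0"
    then have "f (k * r) \<le> f (k * r + R)" "f R \<le> f (k * r + R)"
      using assms R by (auto intro!: sublinear_mono[OF f])
    then show "a * max 0 (f (k * r)) + b \<le> a * f (k * r + R) + b"
      using assms R by (intro add_right_mono mult_left_mono) auto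
  qed (use assms R in auto)
  ultimately show ?thesis by (simp add: asymptotic_def)
qed

lemma sublinear_small:
  assumes "sublinear f" "e > 0"
  obtains C where "C > 0" "\<And>r. r \<ge> C \<Longrightarrow> f r \<le> e * r"
proof -
  have "\<forall>\<^sub>F r in at_top. f r / r < e"
    using assms by (auto simp: sublinear_def intro: order_tendstoD)
  then obtain N where N: "\<And>r. r \<ge> N \<Longrightarrow> f r / r < e"
    by (auto simp: eventually_at_top_linorder)
  have "f r \<le> e * r" if "r \<ge> max 1 N" for r
    using N[of r] that by (simp add: divide_simps)
  then show thesis by (intro that[of "max 1 N"]) auto
qed

section \<open>Geodesic segments and the distance to \<open>Y\<close>\<close>

lemma geodesic_segmentE:
  assumes "geodesic_segment \<gamma> x y"
  obtains l c where "l \<ge> 0" "c 0 = x" "c l = y" "\<gamma> = c ` {0..l}"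
    "\<And>s t. s \<in> {0..l} \<Longrightarrow> t \<in> {0..l} \<Longrightarrow> dist (c s) (c t) = \<bar>s - t\<bar>"
  using assms unfolding geodesic_segment_def by blast

lemma setdist_le_infdist:
  assumes "z \<in> S"
  shows "setdist S Y \<le> infdist z Y"
  unfolding infdist_eq_setdist using assms by (intro setdist_subset_left) auto

text \<open>The distance to \<open>Y\<close> is 1-Lipschitz and a segment has finite length.
  Boundedness is what makes the real supremum in the segment condition an upper bound.\<close>

lemma bdd_above_infdist_segment:
  assumes "geodesic_segment \<gamma> x y"
  shows "bdd_above ((\<lambda>z. infdist z Y) ` \<gamma>)"
proof -
  obtain l c where c: "l \<ge> 0" "c 0 = x" "\<gamma> = c ` {0..l}"
    "\<And>s t. s \<in> {0..l} \<Longrightarrow> t \<in> {0..l} \<Longrightarrow> dist (c s) (c t) = \<bar>s - t\<bar>"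
    using assms by (elim geodesic_segmentE) blast
  have "infdist z Y \<le> infdist x Y + l" if "z \<in> \<gamma>" for z
  proof -
    obtain t where "t \<in> {0..l}" "z = c t" using \<open>z \<in> \<gamma>\<close> c(3) by blast
    then show ?thesis
      using c(1,2) c(4)[of t 0] infdist_triangle[of z Y x] by auto
  qed
  then show ?thesis by (meson bdd_aboveI2)
qed

section \<open>From the endpoint condition to the segment condition\<close>

text \<open>The endpoints lie on the segment, so the larger of their distances to \<open>Y\<close>
  is at most the supremum; by monotonicity the same function and constant serve.\<close>

lemma endpoint_imp_segment:
  assumes "endpoint_condition \<epsilon> Y \<rho>"
  shows "segment_condition \<epsilon> Y \<rho>"
proof -
  obtain C where \<rho>: "sublinear \<rho>" and C: "C \<ge> 0"
    "\<And>\<gamma> x y. geodesic_segment \<gamma> x y \<Longrightarrow> setdist \<gamma> Y \<ge> C \<Longrightarrow>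
        diam_le (proj_set \<epsilon> Y \<gamma>) (\<rho> (max (infdist x Y) (infdist y Y)))"
    using assms unfolding endpoint_condition_def by blast
  have "diam_le (proj_set \<epsilon> Y \<gamma>) (\<rho> (SUP z\<in>\<gamma>. infdist z Y))"
    if g: "geodesic_segment \<gamma> x y" "setdist \<gamma> Y \<ge> C" for \<gamma> x y
  proof -
    have "x \<in> \<gamma>" "y \<in> \<gamma>"
      using g(1) by (force elim!: geodesic_segmentE)+
    then have "max (infdist x Y) (infdist y Y) \<le> (SUP z\<in>\<gamma>. infdist z Y)"
      using bdd_above_infdist_segment[OF g(1)] by (auto intro!: cSUP_upper)
    then have "\<rho> (max (infdist x Y) (infdist y Y)) \<le> \<rho> (SUP z\<in>\<gamma>. infdist z Y)"
      by (intro sublinear_mono[OF \<rho>]) (auto simp: le_max_iff_disj infdist_nonneg)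
    with C(2)[OF g] show ?thesis by (auto simp: diam_le_def)
  qed
  then show ?thesis
    unfolding segment_condition_def using \<rho> C(1) by blast
qed

section \<open>From the segment condition to contraction\<close>

lemma segment_imp_contracting:
  fixes Y :: "'a::metric_space set"
  assumes geo: "geodesic_space TYPE('a)" and "\<epsilon> \<ge> 0" and ne: "{} \<notin> range (proj \<epsilon> Y)"
    and "segment_condition \<epsilon> Y \<rho>"
  shows "\<exists>\<rho>''. contracting \<epsilon> Y \<rho>'' \<and> asymptotic \<rho> \<rho>''"
proof -
  obtain C where \<rho>: "sublinear \<rho>" and C: "C \<ge> 0"
    "\<And>\<gamma> x y. geodesic_segment \<gamma> x y \<Longrightarrow> setdist \<gamma> Y \<ge> C \<Longrightarrow>
        diam_le (proj_set \<epsilon> Y \<gamma>) (\<rho> (SUP z\<in>\<gamma>. infdist z Y))"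
    using assms unfolding segment_condition_def by blast
  have nonempty: "\<exists>u. u \<in> proj \<epsilon> Y x" for x
    using ne by (metis ex_in_conv rangeI)
  then have "Y \<noteq> {}" by (auto simp: proj_def)
  \<comment> \<open>Points within \<open>infdist x Y\<close> of \<open>x\<close> have height
    (distance to \<open>Y\<close>) at most \<open>2 * infdist x Y\<close>, whence the factor 2. The
    constant is twice \<open>3 * C + \<epsilon>\<close>, the radius of a ball that contains
    projections of points near height \<open>C\<close>.\<close>
  define \<rho>'' where "\<rho>'' = (\<lambda>r. 1 * max 0 (\<rho> (2 * r)) + (6 * C + 2 * \<epsilon>))"
  have K: "6 * C + 2 * \<epsilon> \<ge> 0" using C \<open>\<epsilon> \<ge> 0\<close> by simp
  have "sublinear \<rho>''"
    unfolding \<rho>''_def using K by (intro sublinear_rescale[OF \<rho>]) auto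
  moreover have "asymptotic \<rho> \<rho>''"
    unfolding \<rho>''_def using K by (intro asymptotic_rescale[OF \<rho>]) auto
  moreover have "diam_le (proj \<epsilon> Y x \<union> proj \<epsilon> Y x') (\<rho>'' (infdist x Y))"
    if xx': "dist x x' \<le> infdist x Y" for x x'
  proof -
    let ?f = "\<lambda>z. infdist z Y"
    have pr: "dist z u \<le> ?f z + \<epsilon>" if "u \<in> proj \<epsilon> Y z" for z u
      using that by (simp add: proj_def)
    have \<rho>''0: "\<rho>'' (?f x) \<ge> 6 * C + 2 * \<epsilon>" by (simp add: \<rho>''_def)
    have \<rho>''1: "\<rho>'' (?f x) \<ge> \<rho> (2 * ?f x) + (6 * C + 2 * \<epsilon>)" by (simp add: \<rho>''_def)
    obtain l c where c: "l \<ge> 0" "c 0 = x" "c l = x'"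
      "\<And>s t. s \<in> {0..l} \<Longrightarrow> t \<in> {0..l} \<Longrightarrow> dist (c s) (c t) = \<bar>s - t\<bar>"
      using geo unfolding geodesic_space_def by (metis geodesic_segmentE)
    have l: "l \<le> ?f x" using xx' c(1-3) c(4)[of 0 l] by auto
    have cont: "continuous_on {0..l} (\<lambda>t. ?f (c t))"
    proof (intro continuous_on_infdist)
      show "continuous_on {0..l} c"
        unfolding continuous_on_iff using c(4) by (metis dist_real_def)
    qed
    \<comment> \<open>The segment condition is applied to the part of the geodesic before parameter
      \<open>b\<close>, which stays at height at least \<open>C\<close>.\<close>
    have initial: "dist u v \<le> \<rho> (2 * ?f x)"
      if b: "b \<in> {0..l}" "\<And>t. t \<in> {0..b} \<Longrightarrow> ?f (c t) \<ge> C"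
        and uv: "u \<in> proj \<epsilon> Y x \<union> proj \<epsilon> Y (c b)" "v \<in> proj \<epsilon> Y x \<union> proj \<epsilon> Y (c b)" for b u v
    proof -
      let ?g = "c ` {0..b}"
      have g: "geodesic_segment ?g x (c b)"
        unfolding geodesic_segment_def using c b by (intro exI[of _ b] conjI exI[of _ c]) auto
      have sd: "setdist ?g Y \<ge> C"
      proof (rule le_setdistI)
        fix z y assume "z \<in> ?g" "y \<in> Y"
        then show "C \<le> dist z y"
          using b(2) infdist_le[of y Y z] by fastforce
      qed (use b \<open>Y \<noteq> {}\<close> in auto)
      have "?f z \<le> 2 * ?f x" if "z \<in> ?g" for z
      proof -
        obtain t where "t \<in> {0..b}" "z = c t" using \<open>z \<in> ?g\<close> by blast
        then show ?thesis
          using c(2) c(4)[of t 0] b(1) l infdist_triangle[of z Y x] by auto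
      qed
      then have "(SUP z\<in>?g. ?f z) \<le> 2 * ?f x"
        using b(1) by (intro cSUP_least) auto
      moreover have "0 \<le> (SUP z\<in>?g. ?f z)"
      proof (rule cSUP_upper2[OF bdd_above_infdist_segment[OF g]])
        show "x \<in> ?g" using b(1) c(2) by force
      qed (rule infdist_nonneg)
      ultimately have le: "\<rho> (SUP z\<in>?g. ?f z) \<le> \<rho> (2 * ?f x)"
        by (intro sublinear_mono[OF \<rho>])
      have "x \<in> ?g" "c b \<in> ?g" using b(1) c(2) by force+
      then have "u \<in> proj_set \<epsilon> Y ?g" "v \<in> proj_set \<epsilon> Y ?g"
        using uv by (auto simp: proj_set_def)
      then show ?thesis using diam_leD[OF C(2)[OF g sd]] le by fastforce
    qed
    show ?thesis
    proof (cases "?f x < C")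
      \<comment> \<open>Here \<open>x\<close> itself is below the threshold, so the segment
        condition says nothing, but \<open>x'\<close> has height at most \<open>2 * C\<close> and
        both projections lie near \<open>x\<close>.\<close>
      case True
      have near: "dist x u \<le> 3 * C + \<epsilon>" if "u \<in> proj \<epsilon> Y x \<union> proj \<epsilon> Y x'" for u
        using that pr[of u x] pr[of u x'] True xx' C(1) infdist_triangle[of x' Y x]
          dist_triangle[of x u x'] by (auto simp: dist_commute)
      then have "dist u v \<le> 6 * C + 2 * \<epsilon>"
        if "u \<in> proj \<epsilon> Y x \<union> proj \<epsilon> Y x'" "v \<in> proj \<epsilon> Y x \<union> proj \<epsilon> Y x'" for u v
        using near[OF that(1)] near[OF that(2)] dist_triangle3[of u v x] by linarith
      then show ?thesis
        using \<rho>''0 K by (intro diam_leI) force+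
    next
      case False
      have below: "\<exists>s\<in>{0..t}. ?f (c s) = C" if "t \<in> {0..l}" "?f (c t) \<le> C" for t
        using IVT2'[of "\<lambda>t. ?f (c t)" t C 0] that False c(2) continuous_on_subset[OF cont, of "{0..t}"]
        by auto
      show ?thesis
      proof (cases "\<exists>t\<in>{0..l}. ?f (c t) = C")
        case False
        then have "?f (c t) \<ge> C" if "t \<in> {0..l}" for t
          using below[of t] that by force
        then have "dist u v \<le> \<rho> (2 * ?f x)"
          if "u \<in> proj \<epsilon> Y x \<union> proj \<epsilon> Y x'" "v \<in> proj \<epsilon> Y x \<union> proj \<epsilon> Y x'" for u v
          using initial[of l u v] c that by auto
        then show ?thesis
          using \<rho>''1 \<rho>''0 K by (intro diam_leI) force+
      next
        case True
        \<comment> \<open>The level set is compact, so it has a least element \<open>b\<close>: the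
          first time at height \<open>C\<close>.\<close>
        define T where "T = {t \<in> {0..l}. ?f (c t) = C}"
        have "compact T"
          unfolding T_def using continuous_closed_preimage_constant[OF cont]
          by (intro compact_eq_bounded_closed[THEN iffD2] conjI)
            (auto intro: bounded_subset[of "{0..l}"])
        moreover have "T \<noteq> {}" using True by (auto simp: T_def)
        ultimately obtain b where b: "b \<in> T" "\<And>t. t \<in> T \<Longrightarrow> b \<le> t"
          using compact_attains_inf[of T] by blast
        have bl: "b \<in> {0..l}" and fb: "?f (c b) = C" using b(1) by (auto simp: T_def)
        have above: "?f (c t) \<ge> C" if t: "t \<in> {0..b}" for t
        proof (rule ccontr)
          assume lt: "\<not> C \<le> ?f (c t)"
          then obtain s where "s \<in> {0..t}" "?f (c s) = C"
            using below[of t] t bl by auto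
          moreover from this have "b \<le> s" using t bl by (intro b(2)) (auto simp: T_def)
          ultimately have "t = b" using t by auto
          with lt fb show False by simp
        qed
        \<comment> \<open>The point \<open>w\<close> links the two pieces: the segment condition
          compares it with the projection of \<open>x\<close>, and closeness of \<open>c b\<close>
          to \<open>x'\<close> compares it with that of \<open>x'\<close>.\<close>
        obtain w where w: "w \<in> proj \<epsilon> Y (c b)" using nonempty by blast
        \<comment> \<open>Descending from height \<open>?f x\<close> to \<open>C\<close> takes at
          least this length, and the total length is at most \<open>?f x\<close>.\<close>
        have "?f x - C \<le> b"
          using infdist_triangle[of x Y "c b"] fb c(2) c(4)[of 0 b] bl by auto
        then have "dist (c b) x' \<le> C"
          using c(3) c(4)[of b l] bl l by auto
        moreover have "?f x' \<le> ?f (c b) + dist (c b) x'"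
          using infdist_triangle[of x' Y "c b"] by (simp add: dist_commute)
        ultimately have x'b: "dist (c b) v \<le> 3 * C + \<epsilon>" if "v \<in> proj \<epsilon> Y x'" for v
          using pr[OF that] dist_triangle[of "c b" v x'] fb by linarith
        have wb: "dist (c b) w \<le> C + \<epsilon>" using pr[OF w] fb by simp
        have near: "dist u v \<le> \<rho> (2 * ?f x)" if "u \<in> proj \<epsilon> Y x" "v \<in> proj \<epsilon> Y x \<union> {w}" for u v
          using initial[OF bl above] that w by auto
        have far: "dist u v \<le> \<rho> (2 * ?f x) + (6 * C + 2 * \<epsilon>)"
          if "u \<in> proj \<epsilon> Y x" "v \<in> proj \<epsilon> Y x'" for u v
          using near[of u w] that x'b[OF that(2)] wb C(1) \<open>\<epsilon> \<ge> 0\<close>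
            dist_triangle[of u v w] dist_triangle3[of w v "c b"] by auto
        have "dist u v \<le> \<rho>'' (?f x)"
          if "u \<in> proj \<epsilon> Y x \<union> proj \<epsilon> Y x'" "v \<in> proj \<epsilon> Y x \<union> proj \<epsilon> Y x'" for u v
          using that
        proof (elim UnE)
          assume "u \<in> proj \<epsilon> Y x" "v \<in> proj \<epsilon> Y x"
          then show ?thesis using near[of u v] \<rho>''1 K by auto
        next
          assume "u \<in> proj \<epsilon> Y x" "v \<in> proj \<epsilon> Y x'"
          then show ?thesis using far[of u v] \<rho>''1 by auto
        next
          assume "u \<in> proj \<epsilon> Y x'" "v \<in> proj \<epsilon> Y x"
          then show ?thesis using far[of v u] \<rho>''1 by (auto simp: dist_commute)
        next
          assume "u \<in> proj \<epsilon> Y x'" "v \<in> proj \<epsilon> Y x'"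
          then show ?thesis
            using x'b[of u] x'b[of v] \<rho>''0 dist_triangle3[of u v "c b"] by auto
        qed
        then show ?thesis
          using \<rho>''0 K by (intro diam_leI) auto
      qed
    qed
  qed
  ultimately show ?thesis
    unfolding contracting_def using ne by blast
qed

section \<open>From contraction to the endpoint condition\<close>

text \<open>
  The coefficients make the induction close: one step has length \<open>h = infdist (c s) Y\<close>, moves the
  projection by at most \<open>h / 10\<close>, and may double the height, so it needs \<open>h / 10 + 2 h / 10 \<le> h / 10 + h / 5\<close>.
\<close>
lemma projection_path_bound:
  assumes step: "\<And>x x' u v. dist x x' \<le> infdist x Y \<Longrightarrow> C \<le> infdist x Y \<Longrightarrow>
      u \<in> proj \<epsilon> Y x \<Longrightarrow> v \<in> proj \<epsilon> Y x' \<Longrightarrow> dist u v \<le> infdist x Y / 10"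
    and ne: "{} \<notin> range (proj \<epsilon> Y)" and "C > 0"
    and c: "\<And>s t. s \<in> {a..b} \<Longrightarrow> t \<in> {a..b} \<Longrightarrow> dist (c s) (c t) = \<bar>s - t\<bar>"
    and high: "\<And>t. t \<in> {a..b} \<Longrightarrow> C \<le> infdist (c t) Y"
    and st: "a \<le> s" "s \<le> t" "t \<le> b" and uv: "u \<in> proj \<epsilon> Y (c s)" "v \<in> proj \<epsilon> Y (c t)"
  shows "dist u v \<le> infdist (c s) Y / 10 + (t - s) / 5"
proof -
  \<comment> \<open>Induction on the number of lengths \<open>C\<close> needed to cover
    \<open>t - s\<close>. Each step has length at least \<open>C\<close>, hence uses up one of them;
    the start \<open>s\<close>, \<open>u\<close> varies while \<open>t\<close>, \<open>v\<close>
    stay fixed.\<close>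
  have "dist u v \<le> infdist (c s) Y / 10 + (t - s) / 5"
    if "t - s \<le> real n * C" "a \<le> s" "s \<le> t" "u \<in> proj \<epsilon> Y (c s)" for n s u
    using that
  proof (induction n arbitrary: s u)
    case 0
    then have "s = t" by simp
    then show ?case
      using step[of "c s" "c s" u v] 0 high[of s] uv st by (auto simp: infdist_nonneg)
  next
    case (Suc n)
    let ?h = "infdist (c s) Y"
    have h: "C \<le> ?h" using Suc.prems st by (intro high) auto
    show ?case
    proof (cases "t - s \<le> ?h")
      case True
      then have "dist u v \<le> ?h / 10"
        using step[of "c s" "c t" u v] c[of s t] Suc.prems h uv st by auto
      moreover have "0 \<le> (t - s) / 5" using Suc.prems by simp
      ultimately show ?thesis by linarith
    next
      case False
      let ?s = "s + ?h"
      have s: "?s \<in> {a..b}" "s \<in> {a..b}" "?s \<le> t" using False Suc.prems h \<open>C > 0\<close> st by auto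
      have d: "dist (c s) (c ?s) = ?h" using c s by (simp add: infdist_nonneg)
      obtain w where w: "w \<in> proj \<epsilon> Y (c ?s)"
        using ne by (metis ex_in_conv rangeI)
      have "dist u w \<le> ?h / 10"
        using step[of "c s" "c ?s" u w] d h w Suc.prems by auto
      moreover have "dist w v \<le> infdist (c ?s) Y / 10 + (t - ?s) / 5"
        using Suc.prems h s w by (intro Suc.IH) (auto simp: algebra_simps)
      moreover have "infdist (c ?s) Y \<le> 2 * ?h"
        using infdist_triangle[of "c ?s" Y "c s"] d by (simp add: dist_commute)
      ultimately show ?thesis
        using dist_triangle[of u v w] by argo
    qed
  qed
  moreover obtain n where "t - s \<le> real n * C"
    using reals_Archimedean3[OF \<open>C > 0\<close>] by (meson less_imp_le)
  ultimately show ?thesis using st uv by blast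
qed

lemma contracting_imp_endpoint:
  fixes Y :: "'a::metric_space set"
  assumes "\<epsilon> \<ge> 0" and contr: "contracting \<epsilon> Y \<rho>''"
  shows "\<exists>\<rho>. endpoint_condition \<epsilon> Y \<rho> \<and> asymptotic \<rho> \<rho>''"
proof -
  let ?f = "\<lambda>z. infdist z Y"
  have sub: "sublinear \<rho>''" and ne: "{} \<notin> range (proj \<epsilon> Y)"
    using contr by (auto simp: contracting_def)
  have contr: "dist u v \<le> \<rho>'' (?f x)"
    if "dist x x' \<le> ?f x" "u \<in> proj \<epsilon> Y x \<union> proj \<epsilon> Y x'" "v \<in> proj \<epsilon> Y x \<union> proj \<epsilon> Y x'" for x x' u v
    using contr that unfolding contracting_def by (blast intro: diam_leD)
  have nonempty: "\<exists>u. u \<in> proj \<epsilon> Y x" for x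
    using ne by (metis ex_in_conv rangeI)
  have pr: "dist z u \<le> ?f z + \<epsilon>" if "u \<in> proj \<epsilon> Y z" for z u
    using that by (simp add: proj_def)
  \<comment> \<open>This \<open>C\<close> also serves as the constant of the endpoint condition, so
    that \<open>step\<close> is available all along the segment.\<close>
  obtain C where C: "C > 0" "\<And>r. r \<ge> C \<Longrightarrow> \<rho>'' r \<le> 1 / 10 * r"
    using sublinear_small[OF sub, of "1 / 10"] by auto
  have step: "dist u v \<le> ?f x / 10"
    if "dist x x' \<le> ?f x" "C \<le> ?f x" "u \<in> proj \<epsilon> Y x" "v \<in> proj \<epsilon> Y x'" for x x' u v
    using contr[of x x' u v] C(2)[of "?f x"] that by auto
  \<comment> \<open>Every projection point will lie within \<open>4 * R + \<epsilon>\<close> of one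
    point \<open>p\<close>, where \<open>R = \<rho>'' (2 * M)\<close>; the diameter bound is twice
    that.\<close>
  define \<rho> where "\<rho> = (\<lambda>r. 8 * max 0 (\<rho>'' (2 * r)) + 2 * \<epsilon>)"
  have "sublinear \<rho>"
    unfolding \<rho>_def using \<open>\<epsilon> \<ge> 0\<close> by (intro sublinear_rescale[OF sub]) auto
  moreover have "asymptotic \<rho> \<rho>''"
    unfolding \<rho>_def using \<open>\<epsilon> \<ge> 0\<close> by (intro asymptotic_sym[OF asymptotic_rescale[OF sub]]) auto
  moreover have "diam_le (proj_set \<epsilon> Y \<gamma>) (\<rho> (max (?f x) (?f y)))"
    if g: "geodesic_segment \<gamma> x y" and far: "C \<le> setdist \<gamma> Y" for \<gamma> x y
  proof -
    define M where "M = max (?f x) (?f y)"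
    define R where "R = \<rho>'' (2 * M)"
    obtain l c where c: "l \<ge> 0" "c 0 = x" "c l = y" "\<gamma> = c ` {0..l}"
      "\<And>s t. s \<in> {0..l} \<Longrightarrow> t \<in> {0..l} \<Longrightarrow> dist (c s) (c t) = \<bar>s - t\<bar>"
      using geodesic_segmentE[OF g] by metis
    have high: "C \<le> ?f (c t)" if "t \<in> {0..l}" for t
      using far setdist_le_infdist[of "c t" \<gamma> Y] that c(4) by force
    have fx: "0 \<le> ?f x" "?f x \<le> M" and fy: "0 \<le> ?f y" "?f y \<le> M"
      by (auto simp: M_def infdist_nonneg)
    \<comment> \<open>The height bound is \<open>2 * M\<close> rather than \<open>M\<close> because
      contraction is also applied at the end of the initial piece, which may be twice as high as
      \<open>x\<close>.\<close>
    have contrM: "dist u v \<le> R"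
      if "dist z z' \<le> ?f z" "?f z \<le> 2 * M" "u \<in> proj \<epsilon> Y z \<union> proj \<epsilon> Y z'"
        "v \<in> proj \<epsilon> Y z \<union> proj \<epsilon> Y z'" for z z' u v
    proof -
      have "\<rho>'' (?f z) \<le> R"
        unfolding R_def using that by (intro sublinear_mono[OF sub]) (auto simp: infdist_nonneg)
      then show ?thesis using contr[OF that(1,3,4)] by linarith
    qed
    obtain p where p: "p \<in> proj \<epsilon> Y x" using nonempty by blast
    obtain q where q: "q \<in> proj \<epsilon> Y y" using nonempty by blast
    have "0 \<le> R" using contrM[of x x p p] p fx by auto
    have nearx: "dist p v \<le> R" if "t \<in> {0..l}" "t \<le> ?f x" "v \<in> proj \<epsilon> Y (c t)" for t v
      using contrM[of x "c t" p v] c(2) c(5)[of 0 t] that p fx by auto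
    have neary: "dist q v \<le> R" if "t \<in> {0..l}" "l - t \<le> ?f y" "v \<in> proj \<epsilon> Y (c t)" for t v
      using contrM[of y "c t" q v] c(3) c(5)[of l t] that q fy by auto
    have bound: "dist p v \<le> 4 * R + \<epsilon>" if t: "t \<in> {0..l}" and v: "v \<in> proj \<epsilon> Y (c t)" for t v
    proof (cases "l \<le> ?f x + ?f y")
      case True
      \<comment> \<open>The two end pieces cover the geodesic, and \<open>m\<close> is a parameter
        common to both, through which the projections of \<open>x\<close> and \<open>y\<close> are
        compared.\<close>
      define m where "m = min l (?f x)"
      have m: "m \<in> {0..l}" "m \<le> ?f x" "l - m \<le> ?f y"
        using True c(1) fx fy by (auto simp: m_def)
      obtain w where w: "w \<in> proj \<epsilon> Y (c m)" using nonempty by blast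
      show ?thesis
      proof (cases "t \<le> ?f x")
        case True
        then show ?thesis using nearx[OF t _ v] \<open>0 \<le> R\<close> \<open>\<epsilon> \<ge> 0\<close> by simp
      next
        case False
        then have "l - t \<le> ?f y" using True by simp
        then show ?thesis
          using nearx[OF m(1,2) w] neary[OF m(1,3) w] neary[OF t _ v] \<open>0 \<le> R\<close> \<open>\<epsilon> \<ge> 0\<close>
            dist_triangle[of p v w] dist_triangle3[of w v q] by linarith
      qed
    next
      case False
      define a where "a = ?f x"
      define b where "b = l - ?f y"
      have ab: "a \<in> {0..l}" "b \<in> {0..l}" "a \<le> b"
        using False fx fy by (auto simp: a_def b_def)
      have dxa: "dist x (c a) = ?f x"
        using c(2) c(5)[of 0 a] ab by (auto simp: a_def)
      obtain pa where pa: "pa \<in> proj \<epsilon> Y (c a)" using nonempty by blast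
      obtain qb where qb: "qb \<in> proj \<epsilon> Y (c b)" using nonempty by blast
      have ppa: "dist p pa \<le> R" using nearx[OF ab(1) _ pa] by (simp add: a_def)
      have qqb: "dist q qb \<le> R" using neary[OF ab(2) _ qb] by (simp add: b_def)
      have "?f (c a) \<le> 2 * ?f x"
        using infdist_triangle[of "c a" Y x] dxa by (simp add: dist_commute)
      then have fa: "?f (c a) \<le> 2 * M" using fx by linarith
      \<comment> \<open>If one contraction step from \<open>c a\<close> reaches \<open>c s\<close>,
        the bound is immediate. Otherwise the middle piece is longer than the height of
        \<open>c a\<close>, which lets the path bound be expressed by its length alone.\<close>
      have middle: "dist pa w \<le> R + \<epsilon>"
        if s: "s \<in> {a..b}" and w: "w \<in> proj \<epsilon> Y (c s)" for s w
      proof (cases "s - a \<le> ?f (c a)")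
        case True
        then have "dist pa w \<le> R"
          using contrM[of "c a" "c s" pa w] fa pa w c(5)[of a s] ab s by auto
        then show ?thesis using \<open>\<epsilon> \<ge> 0\<close> by simp
      next
        case False
        have path: "dist pa w \<le> ?f (c a) / 10 + (s - a) / 5"
          if "s \<in> {a..b}" "w \<in> proj \<epsilon> Y (c s)" for s w
          using that ab pa c(5) high
          by (intro projection_path_bound[where C = C and a = a and b = b and c = c and \<epsilon> = \<epsilon>]
              step ne C(1)) auto
        have L: "?f (c a) \<le> b - a" using False s by simp
        have D: "dist pa qb \<le> 3 * (b - a) / 10"
        proof -
          have "b \<in> {a..b}" using ab(3) by simp
          from path[OF this qb] L show ?thesis by argo
        qed
        \<comment> \<open>The heights of \<open>x\<close> and \<open>y\<close> on the right cancel
          against the lengths cut off, leaving an estimate of \<open>b - a\<close> by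
          \<open>dist p q\<close>.\<close>
        have "l \<le> dist x p + dist p q + dist q y"
          using c(1-3) c(5)[of 0 l] dist_triangle[of x y p] dist_triangle[of p y q] by auto
        moreover have "dist x p \<le> ?f x + \<epsilon>" "dist q y \<le> ?f y + \<epsilon>"
          using pr[OF p] pr[OF q] by (auto simp: dist_commute)
        moreover have "dist p q \<le> 2 * R + dist pa qb"
          using ppa qqb dist_triangle[of p q pa] dist_triangle2[of pa q qb] by linarith
        moreover have "l = ?f x + ?f y + (b - a)" by (simp add: a_def b_def)
        ultimately have "b - a \<le> 2 * R + 2 * \<epsilon> + 3 * (b - a) / 10" using D by linarith
        moreover have "dist pa w \<le> 3 * (b - a) / 10"
        proof -
          have "s \<le> b" using s by simp
          with path[OF s w] L show ?thesis by argo
        qed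
        \<comment> \<open>Solving for \<open>b - a\<close> gives
          \<open>3 * (b - a) / 10 \<le> 6 / 7 * (R + \<epsilon>)\<close>.\<close>
        ultimately show ?thesis using \<open>0 \<le> R\<close> \<open>\<epsilon> \<ge> 0\<close> by argo
      qed
      consider "t \<le> a" | "t \<in> {a..b}" | "b \<le> t" by force
      then show ?thesis
      proof cases
        case 1
        then show ?thesis using nearx[OF t _ v] \<open>0 \<le> R\<close> \<open>\<epsilon> \<ge> 0\<close> by (simp add: a_def)
      next
        case 2
        then show ?thesis
          using middle[OF 2 v] ppa \<open>0 \<le> R\<close> dist_triangle[of p v pa] by linarith
      next
        \<comment> \<open>The chain runs from \<open>p\<close> through \<open>pa\<close>,
          \<open>qb\<close> and \<open>q\<close> to \<open>v\<close>; this longest case determines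
          the bound \<open>4 * R + \<epsilon>\<close>.\<close>
        case 3
        have "dist q v \<le> R" using neary[OF t _ v] 3 by (simp add: b_def)
        moreover have "dist pa qb \<le> R + \<epsilon>" using middle[OF _ qb] ab by simp
        ultimately show ?thesis
          using ppa qqb dist_triangle[of p v pa] dist_triangle[of pa v qb] dist_triangle3[of qb v q]
          by linarith
      qed
    qed
    have "dist u v \<le> 8 * R + 2 * \<epsilon>" if "u \<in> proj_set \<epsilon> Y \<gamma>" "v \<in> proj_set \<epsilon> Y \<gamma>" for u v
    proof -
      have "dist p u \<le> 4 * R + \<epsilon>" "dist p v \<le> 4 * R + \<epsilon>"
        using that bound c(4) by (auto simp: proj_set_def)
      then show ?thesis using dist_triangle3[of u v p] by linarith
    qed
    moreover have "\<rho> (max (?f x) (?f y)) = 8 * R + 2 * \<epsilon>"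
      using \<open>0 \<le> R\<close> by (simp add: \<rho>_def R_def M_def)
    ultimately show ?thesis
      using \<open>0 \<le> R\<close> \<open>\<epsilon> \<ge> 0\<close> by (intro diam_leI) auto
  qed
  ultimately show ?thesis
    unfolding endpoint_condition_def using C(1) less_imp_le by blast
qed

section \<open>The cycle of implications\<close>

theorem theorem7p1:
  fixes Y :: "'a::metric_space set" and \<epsilon> :: real
  assumes "geodesic_space TYPE('a)"
    and "\<epsilon> \<ge> 0"
    and "{} \<notin> range (proj \<epsilon> Y)"
  shows "((\<exists>\<rho>. endpoint_condition \<epsilon> Y \<rho>) \<longleftrightarrow> (\<exists>\<rho>'. segment_condition \<epsilon> Y \<rho>')) \<and>
    ((\<exists>\<rho>'. segment_condition \<epsilon> Y \<rho>') \<longleftrightarrow> (\<exists>\<rho>''. contracting \<epsilon> Y \<rho>'')) \<and>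
    (\<forall>\<rho>. endpoint_condition \<epsilon> Y \<rho> \<longrightarrow>
       (\<exists>\<rho>' \<rho>''. segment_condition \<epsilon> Y \<rho>' \<and> contracting \<epsilon> Y \<rho>'' \<and>
                  asymptotic \<rho> \<rho>' \<and> asymptotic \<rho>' \<rho>'')) \<and>
    (\<forall>\<rho>'. segment_condition \<epsilon> Y \<rho>' \<longrightarrow>
       (\<exists>\<rho> \<rho>''. endpoint_condition \<epsilon> Y \<rho> \<and> contracting \<epsilon> Y \<rho>'' \<and>
                 asymptotic \<rho> \<rho>' \<and> asymptotic \<rho>' \<rho>'')) \<and>
    (\<forall>\<rho>''. contracting \<epsilon> Y \<rho>'' \<longrightarrow>
       (\<exists>\<rho> \<rho>'. endpoint_condition \<epsilon> Y \<rho> \<and> segment_condition \<epsilon> Y \<rho>' \<and>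
                asymptotic \<rho> \<rho>' \<and> asymptotic \<rho>' \<rho>''))"
proof -
  \<comment> \<open>Each implication supplies a function asymptotic to the given one (the first
    keeps it), so going round the cycle from any condition gives the other two functions.\<close>
  have step23: "\<exists>\<rho>''. contracting \<epsilon> Y \<rho>'' \<and> asymptotic \<rho> \<rho>''" if "segment_condition \<epsilon> Y \<rho>" for \<rho>
    using segment_imp_contracting[OF assms that] .
  note step12 = endpoint_imp_segment
  note step31 = contracting_imp_endpoint[OF \<open>\<epsilon> \<ge> 0\<close>]
  have endp: "\<exists>\<rho>' \<rho>''. segment_condition \<epsilon> Y \<rho>' \<and> contracting \<epsilon> Y \<rho>'' \<and>
      asymptotic \<rho> \<rho>' \<and> asymptotic \<rho>' \<rho>''" if "endpoint_condition \<epsilon> Y \<rho>" for \<rho>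
    using step12[OF that] step23 asymptotic_refl by blast
  have seg: "\<exists>\<rho> \<rho>''. endpoint_condition \<epsilon> Y \<rho> \<and> contracting \<epsilon> Y \<rho>'' \<and>
      asymptotic \<rho> \<rho>' \<and> asymptotic \<rho>' \<rho>''" if "segment_condition \<epsilon> Y \<rho>'" for \<rho>'
    using step23[OF that] step31 asymptotic_sym asymptotic_trans by metis
  have contr: "\<exists>\<rho> \<rho>'. endpoint_condition \<epsilon> Y \<rho> \<and> segment_condition \<epsilon> Y \<rho>' \<and>
      asymptotic \<rho> \<rho>' \<and> asymptotic \<rho>' \<rho>''" if "contracting \<epsilon> Y \<rho>''" for \<rho>''
    using step31[OF that] step12 asymptotic_refl by blast
  show ?thesis
    using endp seg contr by blast
qed

end
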